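(* Let $\mathbf{X}$ be a real $N\times p$ matrix with $N\ge p$ and of full rank (i.e. $\mathrm{rank}(\mathbf{X})=p$), with columns $\mathbf{x}_1,\ldots,\mathbf{x}_p$, and let $\mathbf{y}\in\mathbb{R}^N$. For $\lambda\ge 0$ let $\hat{\boldsymbol\beta}(\lambda)\in\mathbb{R}^p$ be the lasso solution $$\hat{\boldsymbol\beta}(\lambda)=\mathop{\mathrm{argmin}}_{\boldsymbol\beta\in\mathbb{R}^p}\ \tfrac12\|\mathbf{y}-\mathbf{X}\boldsymbol\beta\|_2^2+\lambda\|\boldsymbol\beta\|_1,$$ let $c_j(\lambda)=\mathbf{x}_j^T\{\mathbf{y}-\mathbf{X}\hat{\boldsymbol\beta}(\lambda)\}$ for $j=1,\ldots,p$, and let $\lambda_{\max}=\max_{1\le j\le p}|\mathbf{x}_j^T\mathbf{y}|$. Suppose that the matrix $(\mathbf{X}^T\mathbf{X})^{-1}$ is diagonally dominant. Then, for every $j=1,\ldots,p$, $$|c_j'(\lambda)|\le 1$$ at all points $\lambda>0$ where $c_j$ is differentiable. Hence the basic strong rule and the strong sequential rule never produce violations, that is, for every $j=1,\ldots,p$: (i) (basic strong rule) for every $\lambda\ge 0$, if $|\mathbf{x}_j^T\mathbf{y}|<2\lambda-\lambda_{\max}$, then $\hat\beta_j(\lambda)=0$; (ii) (strong sequential rule) for all $0\le\lambda<\lambda_0$, if $|\mathbf{x}_j^T\{\mathbf{y}-\mathbf{X}\hat{\boldsymbol\beta}(\lambda_0)\}|<2\lambda-\lambda_0$, then $\hat\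beta_j(\lambda)=0$.
   Context: A square matrix $\mathbf{A}$ is called diagonally dominant if $|A_{ii}|\ge\sum_{j\ne i}|A_{ij}|$ for all $i$ (non-strict inequality). The derivative $c_j'$ is taken with respect to $\lambda$. The lasso problem has no intercept term. Since $\mathbf{X}$ has full column rank, the lasso solution $\hat{\boldsymbol\beta}(\lambda)$ is unique for every $\lambda\ge 0$. The basic strong rule discards predictor $j$ for the fit at $\lambda$ if $|\mathbf{x}_j^T\mathbf{y}|<2\lambda-\lambda_{\max}$. The strong sequential rule, given the solution $\hat{\boldsymbol\beta}(\lambda_0)$ at some $\lambda_0>\lambda$, discards predictor $j$ for the fit at $\lambda$ if $|\mathbf{x}_j^T\mathbf{r}|<2\lambda-\lambda_0$, where $\mathbf{r}=\mathbf{y}-\mathbf{X}\hat{\boldsymbol\beta}(\lambda_0)$. A violation of a rule is the event that it discards a predictor $j$ with $\hat\beta_j(\lambda)\neq 0$. *)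

theory Defs
  imports "HOL-Analysis.Analysis"
begin

definition diagonally_dominant :: "real^'p^'p \<Rightarrow> bool" where
  "diagonally_dominant A \<longleftrightarrow> (\<forall>i. \<bar>A $ i $ i\<bar> \<ge> (\<Sum>j\<in>UNIV - {i}. \<bar>A $ i $ j\<bar>))"

definition l1_norm :: "real^'p \<Rightarrow> real" where
  "l1_norm b = (\<Sum>j\<in>UNIV. \<bar>b $ j\<bar>)"

definition lasso_objective :: "real^'p^'n \<Rightarrow> real^'n \<Rightarrow> real \<Rightarrow> real^'p \<Rightarrow> real" where
  "lasso_objective X y l b = 1/2 * (norm (y - X *v b))\<^sup>2 + l * l1_norm b"

(* Meaningful for l \<ge> 0 and X of full column rank: the minimiser then exists and is unique
   (lemma lasso_unique_minimiser below), so the choice made by arg_min is irrelevant. *)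
definition lasso :: "real^'p^'n \<Rightarrow> real^'n \<Rightarrow> real \<Rightarrow> real^'p" where
  "lasso X y l = arg_min (lasso_objective X y l) (\<lambda>b. True)"

definition lasso_corr :: "real^'p^'n \<Rightarrow> real^'n \<Rightarrow> 'p \<Rightarrow> real \<Rightarrow> real" where
  "lasso_corr X y j l = column j X \<bullet> (y - X *v lasso X y l)"

definition lambda_max :: "real^'p^'n \<Rightarrow> real^'n \<Rightarrow> real" where
  "lambda_max X y = (MAX j\<in>UNIV. \<bar>column j X \<bullet> y\<bar>)"

lemma lasso_unique_minimiser:
  fixes X :: "real^'p^'n" and y :: "real^'n"
  assumes rk: "rank X = CARD('p)" and l: "l \<ge> 0"
  shows "\<exists>!b. is_arg_min (lasso_objective X y l) (\<lambda>b. True) b"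
proof -
  let ?f = "lasso_objective X y l"
  have inj: "inj ((*v) X)" using rk by (simp add: full_rank_injective)
  have l1_nonneg: "l1_norm b \<ge> 0" for b :: "real^'p" by (simp add: l1_norm_def sum_nonneg)
  obtain B where B: "B > 0" "\<And>b. norm (X *v b) \<ge> B * norm b"
    using linear_inj_bounded_below_pos[of "(*v) X"] inj by auto
  define R where "R = 2 * norm y / B"
  have R0: "R \<ge> 0" using B by (simp add: R_def)
  have bnd: "b \<in> cball 0 R" if "?f b \<le> ?f 0" for b
  proof -
    have "1/2 * (norm (y - X *v b))\<^sup>2 \<le> ?f b"
      using l l1_nonneg by (simp add: lasso_objective_def)
    also have "\<dots> \<le> 1/2 * (norm y)\<^sup>2"
      using that by (simp add: lasso_objective_def l1_norm_def)
    finally have "norm (y - X *v b) \<le> norm y" by (simp add: power2_le_iff_abs_le)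
    then have "norm (X *v b) \<le> 2 * norm y"
      using norm_triangle_ineq4[of y "y - X *v b"] by simp
    then have "B * norm b \<le> 2 * norm y" using B(2)[of b] by linarith
    then show ?thesis using B(1) by (simp add: R_def field_simps)
  qed
  have "continuous_on (cball 0 R) ?f"
    unfolding lasso_objective_def l1_norm_def by (intro continuous_intros)
  then obtain b0 where b0: "b0 \<in> cball 0 R" "\<And>b. b \<in> cball 0 R \<Longrightarrow> ?f b0 \<le> ?f b"
    using continuous_attains_inf[of "cball (0::real^'p) R" ?f] R0 by auto
  have min: "?f b0 \<le> ?f b" for b
    using b0(2)[of b] b0(2)[of 0] bnd[of b] R0 by (cases "?f b \<le> ?f 0") auto
  have uniq: "a = b" if a: "\<And>x. ?f a \<le> ?f x" and b: "\<And>x. ?f b \<le> ?f x" for a b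
  proof -
    define u where "u = y - X *v a"
    define v where "v = y - X *v b"
    define m where "m = (1/2) *\<^sub>R (a + b)"
    have m: "y - X *v m = (1/2) *\<^sub>R (u + v)"
      by (simp add: m_def u_def v_def matrix_vector_mult_scaleR matrix_vector_right_distrib
          vec_eq_iff field_simps)
    have sq: "(norm ((1/2) *\<^sub>R (u + v)))\<^sup>2 = ((norm u)\<^sup>2 + (norm v)\<^sup>2) / 2 - (norm (u - v))\<^sup>2 / 4"
      by (simp add: power2_norm_eq_inner inner_commute[of v u] inner_add_left inner_add_right
          inner_diff_left inner_diff_right field_simps)
    have "l1_norm m \<le> (\<Sum>j\<in>UNIV. (\<bar>a $ j\<bar> + \<bar>b $ j\<bar>) / 2)"
      unfolding l1_norm_def by (rule sum_mono) (simp add: m_def abs_triangle_ineq)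
    also have "\<dots> = (l1_norm a + l1_norm b) / 2"
      by (simp add: l1_norm_def sum.distrib sum_divide_distrib[symmetric])
    finally have "l * l1_norm m \<le> l * ((l1_norm a + l1_norm b) / 2)"
      using l by (rule mult_left_mono)
    then have "?f m \<le> (?f a + ?f b) / 2 - (norm (u - v))\<^sup>2 / 8"
      unfolding lasso_objective_def m sq u_def[symmetric] v_def[symmetric]
      by (simp add: field_simps)
    moreover have "?f a \<le> ?f m" "?f b \<le> ?f m" using a b by auto
    moreover have "n \<le> 0" if "fm \<le> (fa + fb) / 2 - n / 8" "fa \<le> fm" "fb \<le> fm"
      for fm fa fb n :: real using that by (simp add: field_simps)
    ultimately have "(norm (u - v))\<^sup>2 \<le> 0" by blast
    then have "u = v" by simp
    then have "X *v a = X *v b" by (simp add: u_def v_def)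
    then show ?thesis using inj by (rule injD[rotated])
  qed
  show ?thesis
    by (rule ex1I[of _ b0]) (use min uniq in \<open>auto simp: is_arg_min_linorder\<close>)
qed

end

theory Submission
  imports Defs
begin

text \<open>
  Write \<open>\<beta>(l)\<close> for the lasso solution, \<open>c(l) = X\<^sup>T (y - X \<beta>(l))\<close> for the vector of correlations
  and \<open>W = (X\<^sup>T X)\<inverse>\<close>. All claims follow from the Lipschitz bound
  \<open>\<bar>c\<^sub>j(l) - c\<^sub>j(l0)\<bar> \<le> \<bar>l - l0\<bar>\<close> (lemma \<open>lasso_corr_lipschitz\<close>), which is proved directly for an
  arbitrary pair \<open>l, l0\<close>, without using that the lasso path is piecewise linear.

  Put \<open>h = \<bar>l - l0\<bar>\<close>, \<open>\<Delta>c = c(l) - c(l0)\<close> and \<open>\<Delta>\<beta> = \<beta>(l) - \<beta>(l0)\<close>, so that \<open>\<Delta>\<beta> = - W \<Delta>c\<close>.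
  Clip every entry of \<open>\<Delta>c\<close> to \<open>[-h, h]\<close>, call the result \<open>v\<close>, and let \<open>d = \<Delta>c - v\<close> be the excess.
  The optimality conditions \<open>\<bar>c\<^sub>k\<bar> \<le> l\<close>, with \<open>c\<^sub>k = l sgn \<beta>\<^sub>k\<close> if \<open>\<beta>\<^sub>k \<noteq> 0\<close>, show that an entry of
  \<open>\<Delta>c\<close> that exceeds \<open>h\<close> in modulus has the same sign, weakly, as the corresponding entry of
  \<open>\<Delta>\<beta>\<close>; hence \<open>d \<bullet> \<Delta>\<beta> \<ge> 0\<close>. Diagonal dominance gives \<open>d\<^sub>k (W v)\<^sub>k \<ge> 0\<close> for every \<open>k\<close>, because \<open>v\<close>
  attains its largest possible modulus \<open>h\<close>, with the sign of \<open>d\<^sub>k\<close>, wherever \<open>d\<^sub>k \<noteq> 0\<close>. Therefore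
  \<open>0 \<ge> - d \<bullet> \<Delta>\<beta> = d \<bullet> W d + d \<bullet> W v \<ge> d \<bullet> W d\<close>, and \<open>d = 0\<close> since \<open>W\<close> is positive definite.

  For the strong sequential rule, the bound turns \<open>\<bar>c\<^sub>j(l0)\<bar> < 2 l - l0\<close> into \<open>\<bar>c\<^sub>j(l)\<bar> < l\<close>, which
  forces \<open>\<beta>\<^sub>j(l) = 0\<close>. The basic rule is the case \<open>l0 = lambda_max X y\<close>, where \<open>\<beta>(l0) = 0\<close>.
\<close>

section \<open>Optimality conditions for the lasso\<close>

lemma lasso_minimises:
  fixes X :: "real^'p^'n"
  assumes "rank X = CARD('p)" "l \<ge> 0"
  shows "lasso_objective X y l (lasso X y l) \<le> lasso_objective X y l b"
proof -
  have "is_arg_min (lasso_objective X y l) (\<lambda>b. True) (lasso X y l)"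
    unfolding lasso_def arg_min_def
    using lasso_unique_minimiser[OF assms] by (metis someI_ex)
  then show ?thesis by (simp add: is_arg_min_linorder)
qed

lemma lasso_eqI:
  fixes X :: "real^'p^'n"
  assumes "rank X = CARD('p)" "l \<ge> 0"
    and "\<And>b. lasso_objective X y l a \<le> lasso_objective X y l b"
  shows "lasso X y l = a"
  using lasso_unique_minimiser[OF assms(1,2), of y] assms(3) lasso_minimises[OF assms(1,2)]
  by (auto simp: is_arg_min_linorder)

lemma lasso_objective_add_axis:
  fixes X :: "real^'p^'n"
  shows "lasso_objective X y l (b + axis j t) - lasso_objective X y l b =
    l * (\<bar>b $ j + t\<bar> - \<bar>b $ j\<bar>) - t * (column j X \<bullet> (y - X *v b)) + t\<^sup>2 * (norm (column j X))\<^sup>2 / 2"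
proof -
  have "X *v axis j t = t *\<^sub>R column j X"
    by (simp add: vec_eq_iff matrix_vector_mult_def column_def axis_def if_distrib cong: if_cong)
  then have "y - X *v (b + axis j t) = (y - X *v b) - t *\<^sub>R column j X"
    by (simp add: matrix_vector_right_distrib)
  moreover have "(norm (r - t *\<^sub>R x))\<^sup>2 = (norm r)\<^sup>2 - 2 * t * (x \<bullet> r) + t\<^sup>2 * (norm x)\<^sup>2"
    for r x :: "real^'n"
    unfolding power2_norm_eq_inner
    by (simp add: inner_diff_left inner_diff_right inner_commute power2_eq_square algebra_simps)
  ultimately have sq: "(norm (y - X *v (b + axis j t)))\<^sup>2 =
      (norm (y - X *v b))\<^sup>2 - 2 * t * (column j X \<bullet> (y - X *v b)) + t\<^sup>2 * (norm (column j X))\<^sup>2"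
    by metis
  have "l1_norm (b + axis j t) - l1_norm b = (\<Sum>k\<in>UNIV. \<bar>b $ k + axis j t $ k\<bar> - \<bar>b $ k\<bar>)"
    by (simp add: l1_norm_def sum_subtractf)
  also have "\<dots> = (\<Sum>k\<in>UNIV. if k = j then \<bar>b $ j + t\<bar> - \<bar>b $ j\<bar> else 0)"
    by (rule sum.cong) (auto simp: axis_def)
  finally have l1: "l1_norm (b + axis j t) = l1_norm b + (\<bar>b $ j + t\<bar> - \<bar>b $ j\<bar>)"
    by simp
  show ?thesis
    unfolding lasso_objective_def sq l1 by (simp add: algebra_simps)
qed

lemma nonpos_if_linear_le_quadratic:
  fixes k a e :: real
  assumes "e > 0" and le: "\<And>t. 0 < t \<Longrightarrow> t < e \<Longrightarrow> t * k \<le> t\<^sup>2 * a"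
  shows "k \<le> 0"
proof (rule tendsto_lowerbound)
  show "((\<lambda>t. t * a) \<longlongrightarrow> 0) (at_right 0)"
    by (auto intro!: tendsto_eq_intros)
  have "\<forall>\<^sub>F t in at_right 0. t \<in> {0<..<e}"
    by (rule eventually_at_right_real) fact
  then show "\<forall>\<^sub>F t in at_right 0. k \<le> t * a"
    by (rule eventually_mono) (use le in \<open>force simp: power2_eq_square\<close>)
qed simp

text \<open>
  Optimality of a coordinate \<open>b\<close> under perturbations by \<open>t\<close>, where \<open>c\<close> is its correlation with the
  residual. Only \<open>t > 0\<close> is exploited; the case \<open>t < 0\<close> is obtained by negating \<open>b\<close> and \<open>c\<close>.
\<close>

lemma l1_quadratic_optimality:
  fixes a b c l :: real
  assumes "\<And>t. 0 \<le> l * (\<bar>b + t\<bar> - \<bar>b\<bar>) - t * c + t\<^sup>2 * a" and "l \<ge> 0"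
  shows "c \<le> l" and "b < 0 \<Longrightarrow> c \<le> - l"
proof -
  have "c - l \<le> 0"
  proof (rule nonpos_if_linear_le_quadratic[of 1])
    fix t :: real assume "0 < t"
    then have "l * (\<bar>b + t\<bar> - \<bar>b\<bar>) \<le> l * t"
      using \<open>l \<ge> 0\<close> by (intro mult_left_mono) auto
    then show "t * (c - l) \<le> t\<^sup>2 * a"
      using assms(1)[of t] by (simp add: algebra_simps)
  qed simp
  then show "c \<le> l" by simp
  assume "b < 0"
  have "c + l \<le> 0"
  proof (rule nonpos_if_linear_le_quadratic[of "- b"])
    fix t :: real assume "0 < t" "t < - b"
    then have "\<bar>b + t\<bar> - \<bar>b\<bar> = - t" by simp
    then have "0 \<le> l * (- t) - t * c + t\<^sup>2 * a"
      using assms(1)[of t] by metis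
    then show "t * (c + l) \<le> t\<^sup>2 * a"
      by (simp add: algebra_simps)
  qed (use \<open>b < 0\<close> in simp)
  then show "c \<le> - l" by simp
qed

text \<open>
  The Karush-Kuhn-Tucker conditions. They follow from one-dimensional optimality along each
  coordinate axis; the direction \<open>- axis j 1\<close> yields the conditions for the opposite sign.
\<close>

lemma lasso_KKT:
  fixes X :: "real^'p^'n"
  assumes "rank X = CARD('p)" "l \<ge> 0"
  shows "lasso_corr X y j l \<le> l"
    and "- l \<le> lasso_corr X y j l"
    and "lasso X y l $ j < 0 \<Longrightarrow> lasso_corr X y j l = - l"
    and "lasso X y l $ j > 0 \<Longrightarrow> lasso_corr X y j l = l"
proof -
  let ?b = "lasso X y l $ j" and ?c = "lasso_corr X y j l" and ?a = "(norm (column j X))\<^sup>2 / 2"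
  have opt: "0 \<le> l * (\<bar>?b + t\<bar> - \<bar>?b\<bar>) - t * ?c + t\<^sup>2 * ?a" for t
    using lasso_minimises[OF assms, of y "lasso X y l + axis j t"]
      lasso_objective_add_axis[of X y l "lasso X y l" j t]
    by (simp add: lasso_corr_def)
  have opt': "0 \<le> l * (\<bar>- ?b + t\<bar> - \<bar>- ?b\<bar>) - t * (- ?c) + t\<^sup>2 * ?a" for t
  proof -
    have "\<bar>- ?b + t\<bar> = \<bar>?b + - t\<bar>" by simp
    then show ?thesis using opt[of "- t"] by simp
  qed
  note pos = l1_quadratic_optimality[OF opt \<open>l \<ge> 0\<close>]
  note neg = l1_quadratic_optimality[OF opt' \<open>l \<ge> 0\<close>]
  show "?c \<le> l" "- l \<le> ?c" using pos(1) neg(1) by auto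
  show "?c = - l" if "?b < 0" using pos(2)[OF that] neg(1) by simp
  show "?c = l" if "?b > 0" using neg(2) that pos(1) by simp
qed

lemma lasso_eq_0_if_corr_less:
  fixes X :: "real^'p^'n"
  assumes "rank X = CARD('p)" "l \<ge> 0" "\<bar>lasso_corr X y j l\<bar> < l"
  shows "lasso X y l $ j = 0"
  using lasso_KKT(3,4)[OF assms(1,2), of y j] assms(3)
  by (cases "lasso X y l $ j" "0::real" rule: linorder_cases) auto

lemma lasso_eq_0_if_lambda_max_le:
  fixes X :: "real^'p^'n"
  assumes "rank X = CARD('p)" "lambda_max X y \<le> l"
  shows "lasso X y l = 0"
proof (rule lasso_eqI)
  have max: "\<bar>column j X \<bullet> y\<bar> \<le> l" for j
    using assms(2) unfolding lambda_max_def by (subst (asm) Max_le_iff) auto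
  show "l \<ge> 0" using max[of undefined] by linarith
  fix b
  have "y \<bullet> (X *v b) = (\<Sum>j\<in>UNIV. (b $ j) * (column j X \<bullet> y))"
    by (simp add: matrix_mult_sum scalar_mult_eq_scaleR inner_sum_right inner_commute)
  also have "\<dots> \<le> (\<Sum>j\<in>UNIV. \<bar>b $ j\<bar> * l)"
  proof (rule sum_mono)
    fix j
    have "b $ j * (column j X \<bullet> y) \<le> \<bar>b $ j\<bar> * \<bar>column j X \<bullet> y\<bar>"
      by (metis abs_ge_self abs_mult)
    also have "\<dots> \<le> \<bar>b $ j\<bar> * l" by (intro mult_left_mono max) simp
    finally show "b $ j * (column j X \<bullet> y) \<le> \<bar>b $ j\<bar> * l" .
  qed
  also have "\<dots> = l * l1_norm b"
    by (simp add: l1_norm_def sum_distrib_left mult.commute)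
  finally have "y \<bullet> (X *v b) \<le> l * l1_norm b" .
  moreover have "(norm (y - X *v b))\<^sup>2 = (norm y)\<^sup>2 - 2 * (y \<bullet> (X *v b)) + (norm (X *v b))\<^sup>2"
    by (simp add: power2_norm_eq_inner inner_diff_left inner_diff_right inner_commute)
  moreover have "0 \<le> (norm (X *v b))\<^sup>2" by simp
  moreover have "lasso_objective X y l 0 = (norm y)\<^sup>2 / 2"
    by (simp add: lasso_objective_def l1_norm_def)
  ultimately show "lasso_objective X y l 0 \<le> lasso_objective X y l b"
    unfolding lasso_objective_def by linarith
qed fact

section \<open>The inverse Gram matrix\<close>

lemma inner_transpose_matrix_vector:
  fixes A :: "real^'p^'n"
  shows "(transpose A *v x) \<bullet> u = x \<bullet> (A *v u)"
  by (simp add: dot_lmul_matrix transpose_matrix_vector)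

lemma gram_mult_matrix_inv:
  fixes X :: "real^'p^'n"
  assumes "rank X = CARD('p)"
  shows "(transpose X ** X) ** matrix_inv (transpose X ** X) = mat 1"
    and "matrix_inv (transpose X ** X) ** (transpose X ** X) = mat 1"
proof -
  let ?M = "transpose X ** X"
  have "u = 0" if "?M *v u = 0" for u
  proof -
    have "(norm (X *v u))\<^sup>2 = (?M *v u) \<bullet> u"
      by (simp only: power2_norm_eq_inner inner_transpose_matrix_vector
          flip: matrix_vector_mul_assoc)
    with that have "X *v u = X *v 0" by simp
    then show "u = 0"
      using assms by (metis full_rank_injective injD)
  qed
  then have "invertible ?M"
    by (simp add: invertible_left_inverse matrix_left_invertible_ker)
  then show "?M ** matrix_inv ?M = mat 1" "matrix_inv ?M ** ?M = mat 1"
    unfolding invertible_def matrix_inv_def by (metis (mono_tags, lifting) someI_ex)+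
qed

text \<open>The quadratic form of the inverse Gram matrix, in a form that shows its sign.\<close>

lemma inner_gram_inv:
  fixes X :: "real^'p^'n"
  defines "W \<equiv> matrix_inv (transpose X ** X)"
  assumes "rank X = CARD('p)"
  shows "d \<bullet> (W *v d) = (norm (X *v (W *v d)))\<^sup>2"
proof -
  have "d = transpose X *v (X *v (W *v d))"
    using gram_mult_matrix_inv(1)[OF assms(2)]
    by (simp add: W_def matrix_vector_mul_assoc matrix_mul_assoc)
  then have "d \<bullet> (W *v d) = (transpose X *v (X *v (W *v d))) \<bullet> (W *v d)" by simp
  then show ?thesis
    by (simp only: power2_norm_eq_inner inner_transpose_matrix_vector)
qed

lemma gram_inv_eq_0_if_inner_le_0:
  fixes X :: "real^'p^'n"
  defines "W \<equiv> matrix_inv (transpose X ** X)"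
  assumes "rank X = CARD('p)" "d \<bullet> (W *v d) \<le> 0"
  shows "d = 0"
proof -
  have "X *v (W *v d) = 0"
    using assms(3) inner_gram_inv[OF assms(2), of d] by (simp add: W_def)
  moreover have "d = transpose X *v (X *v (W *v d))"
    using gram_mult_matrix_inv(1)[OF assms(2)]
    by (simp add: W_def matrix_vector_mul_assoc matrix_mul_assoc)
  ultimately show ?thesis by simp
qed

lemma gram_inv_diag_nonneg:
  fixes X :: "real^'p^'n"
  assumes "rank X = CARD('p)"
  shows "0 \<le> matrix_inv (transpose X ** X) $ k $ k"
proof -
  let ?W = "matrix_inv (transpose X ** X)"
  have "?W $ k $ k = axis k 1 \<bullet> (?W *v axis k 1)"
    by (simp add: inner_axis' matrix_vector_mult_basis column_def)
  then show ?thesis using inner_gram_inv[OF assms, of "axis k 1"] by simp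
qed

section \<open>Lipschitz continuity of the correlations\<close>

text \<open>
  If the entries of \<open>v\<close> are bounded by \<open>h\<close> in modulus and the bound is attained at \<open>k\<close>, then
  diagonal dominance gives \<open>(W v)\<^sub>k\<close>, weakly, the sign of \<open>v\<^sub>k\<close>. That sign is recorded by the
  multiplier \<open>x\<close>; if \<open>x = 0\<close>, nothing is required of \<open>v\<^sub>k\<close>.
\<close>

lemma diagonally_dominant_sign:
  fixes W :: "real^'p^'p"
  assumes "diagonally_dominant W" "0 \<le> W $ k $ k"
    and bound: "\<And>i. \<bar>v $ i\<bar> \<le> h" and attained: "x * v $ k = \<bar>x\<bar> * h"
  shows "0 \<le> x * (W *v v) $ k"
proof -
  have h: "0 \<le> h" using bound[of k] by linarith
  have "- (x * (\<Sum>i\<in>UNIV - {k}. W $ k $ i * v $ i)) \<le> (\<Sum>i\<in>UNIV - {k}. \<bar>x\<bar> * h * \<bar>W $ k $ i\<bar>)"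
    unfolding sum_distrib_left sum_negf[symmetric]
  proof (rule sum_mono)
    fix i
    have "- (x * (W $ k $ i * v $ i)) \<le> \<bar>x\<bar> * \<bar>W $ k $ i\<bar> * \<bar>v $ i\<bar>"
      by (metis abs_ge_minus_self abs_mult mult.assoc)
    also have "\<dots> \<le> \<bar>x\<bar> * \<bar>W $ k $ i\<bar> * h" by (intro mult_left_mono bound) simp
    finally show "- (x * (W $ k $ i * v $ i)) \<le> \<bar>x\<bar> * h * \<bar>W $ k $ i\<bar>" by (simp add: mult_ac)
  qed
  also have "\<dots> = \<bar>x\<bar> * h * (\<Sum>i\<in>UNIV - {k}. \<bar>W $ k $ i\<bar>)" by (simp add: sum_distrib_left)
  also have "\<dots> \<le> \<bar>x\<bar> * h * W $ k $ k"
  proof (rule mult_left_mono)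
    have "(\<Sum>i\<in>UNIV - {k}. \<bar>W $ k $ i\<bar>) \<le> \<bar>W $ k $ k\<bar>"
      using assms(1) by (simp add: diagonally_dominant_def)
    with assms(2) show "(\<Sum>i\<in>UNIV - {k}. \<bar>W $ k $ i\<bar>) \<le> W $ k $ k" by simp
  qed (use h in simp)
  also have "\<dots> = x * (W $ k $ k * v $ k)" using attained by (simp add: mult_ac)
  finally have "0 \<le> x * (W $ k $ k * v $ k + (\<Sum>i\<in>UNIV - {k}. W $ k $ i * v $ i))"
    by (simp add: distrib_left)
  then show ?thesis
    by (simp add: matrix_vector_mult_def sum.remove[of UNIV k])
qed

lemma lasso_diff_eq:
  fixes X :: "real^'p^'n"
  assumes "rank X = CARD('p)"
  shows "lasso X y l - lasso X y l0 =
    - (matrix_inv (transpose X ** X) *v (\<chi> j. lasso_corr X y j l - lasso_corr X y j l0))"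
proof -
  let ?W = "matrix_inv (transpose X ** X)"
  have "column j X \<bullet> z = (transpose X *v z) $ j" for j z
    by (simp add: inner_vec_def column_def transpose_def matrix_vector_mult_def
        del: transpose_matrix_vector)
  then have "(\<chi> j. lasso_corr X y j l - lasso_corr X y j l0) =
      transpose X *v (X *v (lasso X y l0 - lasso X y l))"
    by (simp add: vec_eq_iff lasso_corr_def matrix_vector_mult_diff_distrib
        del: transpose_matrix_vector)
  then have "?W *v (\<chi> j. lasso_corr X y j l - lasso_corr X y j l0) =
      (?W ** (transpose X ** X)) *v (lasso X y l0 - lasso X y l)"
    by (simp add: matrix_vector_mul_assoc matrix_mul_assoc)
  then show ?thesis by (simp add: gram_mult_matrix_inv(2)[OF assms])
qed

text \<open>
  If the correlation increases by more than the penalty changes, then \<open>- l < c\<^sub>j(l)\<close> and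
  \<open>c\<^sub>j(l0) < l0\<close>, so that the coefficient is nonnegative at \<open>l\<close> and nonpositive at \<open>l0\<close>. Since
  \<open>l\<close> and \<open>l0\<close> are not ordered, exchanging them covers a decreasing correlation.
\<close>

lemma lasso_mono_if_corr_diff:
  fixes X :: "real^'p^'n"
  assumes "rank X = CARD('p)" "l \<ge> 0" "l0 \<ge> 0"
    and "lasso_corr X y j l - lasso_corr X y j l0 > \<bar>l - l0\<bar>"
  shows "lasso X y l0 $ j \<le> lasso X y l $ j"
proof -
  have "0 \<le> lasso X y l $ j"
  proof (rule ccontr)
    assume "\<not> ?thesis"
    then show False
      using lasso_KKT(3)[OF assms(1,2), of y j] lasso_KKT(2)[OF assms(1,3), of y j] assms(4) by simp
  qed
  moreover have "lasso X y l0 $ j \<le> 0"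
  proof (rule ccontr)
    assume "\<not> ?thesis"
    then show False
      using lasso_KKT(4)[OF assms(1,3), of y j] lasso_KKT(1)[OF assms(1,2), of y j] assms(4) by simp
  qed
  ultimately show ?thesis by simp
qed

lemma lasso_corr_lipschitz:
  fixes X :: "real^'p^'n"
  assumes rk: "rank X = CARD('p)" and dd: "diagonally_dominant (matrix_inv (transpose X ** X))"
    and l: "l \<ge> 0" "l0 \<ge> 0"
  shows "\<bar>lasso_corr X y j l - lasso_corr X y j l0\<bar> \<le> \<bar>l - l0\<bar>"
proof -
  define W where "W = matrix_inv (transpose X ** X)"
  define h where "h = \<bar>l - l0\<bar>"
  define c where "c = (\<chi> j. lasso_corr X y j l - lasso_corr X y j l0)"
  define v where "v = (\<chi> j. max (- h) (min h (c $ j)))"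
  define d where "d = c - v"
  have h: "0 \<le> h" by (simp add: h_def)
  have \<Delta>\<beta>: "lasso X y l - lasso X y l0 = - (W *v c)"
    unfolding W_def c_def by (rule lasso_diff_eq) fact
  have "0 \<le> d \<bullet> (lasso X y l - lasso X y l0)"
    unfolding inner_vec_def
  proof (rule sum_nonneg)
    fix k
    consider "c $ k > h" | "c $ k < - h" | "\<bar>c $ k\<bar> \<le> h" by linarith
    then show "0 \<le> d $ k \<bullet> (lasso X y l - lasso X y l0) $ k"
    proof cases
      case 1
      then have "lasso X y l0 $ k \<le> lasso X y l $ k"
        using lasso_mono_if_corr_diff[OF rk l, of y k] by (simp add: c_def h_def)
      moreover have "0 \<le> d $ k" using 1 h by (simp add: d_def v_def)
      ultimately show ?thesis by simp
    next
      case 2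
      then have "lasso X y l $ k \<le> lasso X y l0 $ k"
        using lasso_mono_if_corr_diff[OF rk l(2,1), of y k] by (simp add: c_def h_def)
      moreover have "d $ k \<le> 0" using 2 h by (simp add: d_def v_def)
      ultimately show ?thesis by (simp add: mult_nonpos_nonpos)
    next
      case 3
      then have "d $ k = 0" by (simp add: d_def v_def)
      then show ?thesis by simp
    qed
  qed
  moreover have "0 \<le> d \<bullet> (W *v v)"
    unfolding inner_vec_def
  proof (rule sum_nonneg)
    fix k
    have "0 \<le> d $ k * (W *v v) $ k"
    proof (rule diagonally_dominant_sign)
      show "diagonally_dominant W" "0 \<le> W $ k $ k"
        using dd gram_inv_diag_nonneg[OF rk] by (auto simp: W_def)
      show "\<bar>v $ i\<bar> \<le> h" for i using h by (auto simp: v_def)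
      show "d $ k * v $ k = \<bar>d $ k\<bar> * h"
        using h by (auto simp: d_def v_def max_def min_def abs_if algebra_simps)
    qed
    then show "0 \<le> d $ k \<bullet> (W *v v) $ k" by simp
  qed
  moreover have "d \<bullet> (W *v c) = d \<bullet> (W *v d) + d \<bullet> (W *v v)"
    by (simp add: d_def matrix_vector_mult_diff_distrib inner_diff_right)
  ultimately have "d \<bullet> (W *v d) \<le> 0" by (simp add: \<Delta>\<beta>)
  then have "d = 0" unfolding W_def by (rule gram_inv_eq_0_if_inner_le_0[OF rk])
  then have "c $ j = v $ j" by (simp add: d_def)
  then have "\<bar>c $ j\<bar> \<le> h" using h by (auto simp: v_def)
  then show ?thesis by (simp add: c_def h_def)
qed

section \<open>Derivative bound and strong rules\<close>

lemma abs_deriv_le_if_eventually_lipschitz: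
  fixes f :: "real \<Rightarrow> real"
  assumes "f differentiable (at x)" and "\<forall>\<^sub>F z in at x. \<bar>f z - f x\<bar> \<le> C * \<bar>z - x\<bar>"
  shows "\<bar>deriv f x\<bar> \<le> C"
proof (rule tendsto_upperbound)
  have "(f has_field_derivative deriv f x) (at x)"
    using assms(1) by (simp add: DERIV_deriv_iff_real_differentiable)
  then show "((\<lambda>z. \<bar>(f z - f x) / (z - x)\<bar>) \<longlongrightarrow> \<bar>deriv f x\<bar>) (at x)"
    by (intro tendsto_rabs) (simp add: has_field_derivative_iff)
  show "\<forall>\<^sub>F z in at x. \<bar>(f z - f x) / (z - x)\<bar> \<le> C"
    using assms(2) eventually_neq_at_within[of x x UNIV]
    by eventually_elim (simp add: divide_le_eq)
qed simp

lemma strong_sequential_rule: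
  fixes X :: "real^'p^'n"
  assumes "rank X = CARD('p)" "diagonally_dominant (matrix_inv (transpose X ** X))"
    and "0 \<le> l" "l < l0" "\<bar>lasso_corr X y j l0\<bar> < 2 * l - l0"
  shows "lasso X y l $ j = 0"
proof (rule lasso_eq_0_if_corr_less)
  show "\<bar>lasso_corr X y j l\<bar> < l"
    using lasso_corr_lipschitz[OF assms(1,2,3), of l0 y j] assms(3-5) by linarith
qed fact+

theorem theorem1:
  fixes X :: "real^'p^'n" and y :: "real^'n"
  assumes "CARD('n) \<ge> CARD('p)"
    and "rank X = CARD('p)"
    and "diagonally_dominant (matrix_inv (transpose X ** X))"
  shows "(\<forall>j. \<forall>l>0. lasso_corr X y j differentiable (at l)
              \<longrightarrow> \<bar>deriv (lasso_corr X y j) l\<bar> \<le> 1)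
    \<and> (\<forall>j. \<forall>l\<ge>0. \<bar>column j X \<bullet> y\<bar> < 2 * l - lambda_max X y
              \<longrightarrow> lasso X y l $ j = 0)
    \<and> (\<forall>j. \<forall>l l0. 0 \<le> l \<and> l < l0
              \<and> \<bar>column j X \<bullet> (y - X *v lasso X y l0)\<bar> < 2 * l - l0
              \<longrightarrow> lasso X y l $ j = 0)"
proof (intro conjI allI impI)
  fix j and l :: real
  assume "l > 0" and diff: "lasso_corr X y j differentiable (at l)"
  from \<open>l > 0\<close> have "\<forall>\<^sub>F z in at l. z > 0"
    by (intro order_tendstoD(1)[OF tendsto_ident_at])
  then have "\<forall>\<^sub>F z in at l. \<bar>lasso_corr X y j z - lasso_corr X y j l\<bar> \<le> 1 * \<bar>z - l\<bar>"
    by eventually_elim (use lasso_corr_lipschitz[OF assms(2,3)] \<open>l > 0\<close> in simp)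
  with diff show "\<bar>deriv (lasso_corr X y j) l\<bar> \<le> 1"
    by (rule abs_deriv_le_if_eventually_lipschitz)
next
  fix j and l :: real
  assume "l \<ge> 0" and disc: "\<bar>column j X \<bullet> y\<bar> < 2 * l - lambda_max X y"
  show "lasso X y l $ j = 0"
  proof (cases "l < lambda_max X y")
    case True
    have "lasso_corr X y j (lambda_max X y) = column j X \<bullet> y"
      by (simp add: lasso_corr_def lasso_eq_0_if_lambda_max_le[OF assms(2)])
    with disc show ?thesis
      by (intro strong_sequential_rule[OF assms(2,3) \<open>l \<ge> 0\<close> True]) simp
  next
    case False
    then show ?thesis by (simp add: lasso_eq_0_if_lambda_max_le[OF assms(2)])
  qed
next
  fix j and l l0 :: real
  assume "0 \<le> l \<and> l < l0 \<and> \<bar>column j X \<bullet> (y - X *v lasso X y l0)\<bar> < 2 * l - l0"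
  then show "lasso X y l $ j = 0"
    by (intro strong_sequential_rule[OF assms(2,3), of l l0]) (auto simp: lasso_corr_def)
qed

end
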